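(* Let $n$ and $d$ be positive integers with $n\geq 6d$, and let $\mathcal{F}\subset 2^{[n]}$ be a $2d$-union family. Then $$|\mathcal{F}\setminus \mathcal{K}(n,2d)|\leq \binom{n-2}{d-1},$$ where $\mathcal{K}(n,2d)=\{K\subset [n]\colon |K|\leq d\}$. (That is, the number of members of $\mathcal{F}$ of size at least $d+1$ is at most $\binom{n-2}{d-1}$.)
   Context: $[n]=\{1,2,\ldots,n\}$ and $2^{[n]}$ is its power set. For a positive integer $u$, a family $\mathcal{F}\subset 2^{[n]}$ is called $u$-union if $|F\cup F'|\leq u$ for all $F,F'\in\mathcal{F}$ (including $F=F'$). *)

theory Defs
  imports Complex_Main
begin

(* Meant for families of finite sets, as card is 0 on infinite sets. *)
definition union_bounded :: "nat \<Rightarrow> 'a set set \<Rightarrow> bool" where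
  "union_bounded u \<F> \<longleftrightarrow> (\<forall>F\<in>\<F>. \<forall>F'\<in>\<F>. card (F \<union> F') \<le> u)"

(* The family K(n, 2d) for an even union bound 2d; the second argument here is d, not 2d. *)
definition katona_even :: "nat \<Rightarrow> nat \<Rightarrow> nat set set" where
  "katona_even n d = {K. K \<subseteq> {1..n} \<and> card K \<le> d}"

end

theory Submission
  imports Defs
begin

text \<open>
  Shifting preserves cardinalities and the union bound, so assume the members of size at least
  \<open>d + 1\<close> form a shifted family. Read a set \<open>F\<close> as a walk with height
  \<open>h\<^sub>F(j) = 2|F \<inter> [j]| - j\<close>. Shiftedness and the union bound give, for members of sizes \<open>d + i\<close> and
  \<open>d + k\<close>, a common \<open>j\<close> with \<open>h\<^sub>F(j) + h\<^sub>G(j) \<ge> 2(i + k)\<close>; in particular a member of size \<open>d + i\<close> hits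
  level \<open>2i\<close>, and the reflection principle bounds the number of such sets. As consecutive binomial
  coefficients drop by a factor 5 when \<open>n \<ge> 6d\<close>, the sizes at least \<open>d + 2\<close> contribute at most
  \<open>5/4 (n choose d - 2)\<close> altogether.

  For size \<open>d + 1\<close> compare with the star of \<open>{1, 2}\<close>. If the family contains \<open>F\<close> with
  \<open>F \<inter> [s] = {1, 2}\<close> that stays at or below \<open>5 - s\<close> afterwards, \<open>s \<ge> 4\<close>, then all the other sets are
  forced to hit levels higher by about \<open>s\<close>, which makes them exponentially rarer than the sets missing from the
  star when \<open>s\<close> is maximal. If there is no such \<open>F\<close> with \<open>s = 4\<close>, the count is done by the size of
  the prefix \<open>F \<inter> [4]\<close>: either every set with at most two elements in \<open>[4]\<close> hits level 3, or one that
  does not rules out enough sets with three elements in \<open>[4]\<close>.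
\<close>

section \<open>Binomial coefficients with integer lower index\<close>

text \<open>An integer lower index lets \<open>d - l\<close> go below zero, where the coefficient has to vanish.\<close>
definition ibinom :: "nat \<Rightarrow> int \<Rightarrow> int" where
  "ibinom m k = (if k < 0 then 0 else int (m choose nat k))"

lemma ibinom_nonneg [simp]: "0 \<le> ibinom m k"
  by (simp add: ibinom_def)

lemma ibinom_neg [simp]: "k < 0 \<Longrightarrow> ibinom m k = 0"
  by (simp add: ibinom_def)

lemma ibinom_of_nat [simp]: "ibinom m (int k) = int (m choose k)"
  by (simp add: ibinom_def)

lemma ibinom_Suc: "ibinom (Suc m) k = ibinom m k + ibinom m (k - 1)"
proof (cases "k \<le> 0")
  case True
  then show ?thesis by (cases "k = 0") (auto simp: ibinom_def)
next
  case False
  then obtain l where "k = int (Suc l)"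
    by (metis gr0_conv_Suc not_le zero_less_imp_eq_int)
  moreover from this have "k - 1 = int l" by simp
  ultimately show ?thesis by (simp only: ibinom_of_nat) simp
qed

lemma ibinom_drop2:
  assumes "2 \<le> m"
  shows "ibinom m k = ibinom (m - 2) k + 2 * ibinom (m - 2) (k - 1) + ibinom (m - 2) (k - 2)"
proof -
  obtain l where "m = Suc (Suc l)" using assms by (metis add_2_eq_Suc le_Suc_ex)
  then show ?thesis by (simp add: ibinom_Suc)
qed

lemma ibinom_symmetric: "ibinom m k = ibinom m (int m - k)"
proof (cases "0 \<le> k \<and> k \<le> int m")
  case True
  then obtain l where "k = int l" by (metis nonneg_int_cases)
  moreover from this True have "int m - k = int (m - l)" "l \<le> m" by auto
  ultimately show ?thesis by (metis binomial_symmetric ibinom_of_nat)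
next
  case False
  then show ?thesis by (auto simp: ibinom_def)
qed

text \<open>Consecutive coefficients have ratio \<open>(m - k + 1) / k\<close>, and the hypothesis
  is \<open>q * k \<le> m - k + 1\<close> rearranged.\<close>

lemma ibinom_ratio:
  assumes "(int q + 1) * k \<le> int m + 1"
  shows "int q * ibinom m (k - 1) \<le> ibinom m k"
proof (cases "k \<le> 0")
  case True
  then show ?thesis by simp
next
  case False
  then obtain l where k: "k = int (Suc l)"
    by (metis gr0_conv_Suc not_le zero_less_imp_eq_int)
  then have k1: "k - 1 = int l" by simp
  show ?thesis
  proof (cases "l \<le> m")
    case True
    have "Suc l * (m choose Suc l) = (m - l) * (m choose l)"
      by (metis binomial_absorb_comp binomial_absorption)
    then have absorb: "k * ibinom m k = (int m - int l) * ibinom m (k - 1)"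
      using True unfolding k1 unfolding k ibinom_of_nat by (metis of_nat_diff of_nat_mult)
    have "k * (int q * ibinom m (k - 1)) = (int q * k) * ibinom m (k - 1)"
      by simp
    also have "\<dots> \<le> (int m - int l) * ibinom m (k - 1)"
      using assms k by (intro mult_right_mono) (auto simp: algebra_simps)
    also have "\<dots> = k * ibinom m k"
      using absorb by simp
    finally show ?thesis
      using False by simp
  next
    case False
    then show ?thesis unfolding k1 ibinom_of_nat by (simp add: binomial_eq_0)
  qed
qed

lemma ibinom_ratio_power:
  assumes "6 * k \<le> int m + 1"
  shows "5 ^ j * ibinom m (k - int j) \<le> ibinom m k"
proof (induction j)
  case 0
  then show ?case by simp
next
  case (Suc j)
  have "5 * ibinom m (k - int j - 1) \<le> ibinom m (k - int j)"
    using ibinom_ratio[of 5 "k - int j" m] assms by simp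
  then have "5 ^ Suc j * ibinom m (k - int (Suc j)) \<le> 5 ^ j * ibinom m (k - int j)"
    by (simp add: algebra_simps)
  with Suc show ?case by linarith
qed

text \<open>By Pascal's rule each further ground element multiplies the coefficient by at most
  \<open>1 + 1/4\<close>.\<close>

lemma ibinom_upper_ratio_power:
  assumes "5 * k \<le> int m + 1"
  shows "4 ^ j * ibinom (m + j) k \<le> 5 ^ j * ibinom m k"
proof (induction j)
  case 0
  then show ?case by simp
next
  case (Suc j)
  have "4 * ibinom (m + j) (k - 1) \<le> ibinom (m + j) k"
    using ibinom_ratio[of 4 k "m + j"] assms by simp
  then have "4 * ibinom (m + Suc j) k \<le> 5 * ibinom (m + j) k"
    by (simp add: ibinom_Suc)
  then have "4 ^ j * (4 * ibinom (m + Suc j) k) \<le> 4 ^ j * (5 * ibinom (m + j) k)"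
    by (rule mult_left_mono) simp
  moreover have "5 * (4 ^ j * ibinom (m + j) k) \<le> 5 * (5 ^ j * ibinom m k)"
    using Suc by linarith
  ultimately show ?case by (simp only: power_Suc mult.assoc mult.left_commute[of "4 ^ j"])
qed

text \<open>Geometric series with ratio \<open>1/5\<close>, whose sum is \<open>5/4\<close> of the
  first term.\<close>

lemma ibinom_sum_le:
  assumes "6 * k \<le> int m + 1"
  shows "4 * (\<Sum>i<N. ibinom m (k - int i)) \<le> 5 * ibinom m k"
  using assms
proof (induction N arbitrary: k)
  case 0
  then show ?case by simp
next
  case (Suc N)
  have "(\<Sum>i<Suc N. ibinom m (k - int i)) = ibinom m k + (\<Sum>i<N. ibinom m (k - 1 - int i))"
    by (subst sum.lessThan_Suc_shift) (simp add: algebra_simps)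
  moreover have "4 * (\<Sum>i<N. ibinom m (k - 1 - int i)) \<le> 5 * ibinom m (k - 1)"
    using Suc.prems by (intro Suc.IH) simp
  moreover have "5 * ibinom m (k - 1) \<le> ibinom m k"
    using ibinom_ratio[of 5 k m] Suc.prems by simp
  ultimately show ?case by linarith
qed

section \<open>Walks and reflection\<close>

text \<open>The position after \<open>j\<close> steps of the walk that goes up at the elements of \<open>F\<close> and down elsewhere.\<close>
definition height :: "nat set \<Rightarrow> nat \<Rightarrow> int" where
  "height F j = 2 * int (card (F \<inter> {1..j})) - int j"

text \<open>The size \<open>k\<close> is an integer so that the recursion to \<open>k - 1\<close> in
  the reflection count needs no case for zero.\<close>

definition slice :: "nat \<Rightarrow> nat \<Rightarrow> nat set \<Rightarrow> int \<Rightarrow> nat set set" where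
  "slice n a P k = {F. F \<subseteq> {1..n} \<and> F \<inter> {1..a} = P \<and> int (card F) = k}"

definition slice_hit :: "nat \<Rightarrow> nat \<Rightarrow> nat set \<Rightarrow> int \<Rightarrow> int \<Rightarrow> nat set set" where
  "slice_hit n a P k r = {F \<in> slice n a P k. \<exists>j\<in>{a..n}. r \<le> height F j}"

lemma finite_slice [simp]: "finite (slice n a P k)"
  by (rule finite_subset[of _ "Pow {1..n}"]) (auto simp: slice_def)

lemma finite_slice_hit [simp]: "finite (slice_hit n a P k r)"
  by (simp add: slice_hit_def)

lemma height_full:
  assumes "F \<subseteq> {1..n}"
  shows "height F n = 2 * int (card F) - int n"
  using assms by (simp add: height_def Int_absorb2)

lemma height_bound: "height F j \<le> int j"
  using card_mono[of "{1..j}" "F \<inter> {1..j}"] by (simp add: height_def)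

lemma prefix_Suc:
  "F \<inter> {1..Suc j} = (if Suc j \<in> F then insert (Suc j) (F \<inter> {1..j}) else F \<inter> {1..j})"
  by (auto simp: le_Suc_eq)

lemma height_Suc: "height F (Suc j) = height F j + (if Suc j \<in> F then 1 else - 1)"
  unfolding height_def prefix_Suc by simp

lemma card_slice:
  assumes "P \<subseteq> {1..a}" "a \<le> n"
  shows "int (card (slice n a P k)) = ibinom (n - a) (k - int (card P))"
proof -
  have finP: "finite P" using assms(1) finite_subset by blast
  show ?thesis
  proof (cases "k < int (card P)")
    case True
    have "slice n a P k = {}"
    proof -
      have "int (card P) \<le> int (card F)" if "F \<subseteq> {1..n}" "F \<inter> {1..a} = P" for F
        using that by (metis card_mono finite_atLeastAtMost finite_subset inf_le1 of_nat_mono)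
      with True have "\<not> (F \<subseteq> {1..n} \<and> F \<inter> {1..a} = P \<and> int (card F) = k)" for F
        using leD by blast
      then show ?thesis unfolding slice_def by blast
    qed
    with True show ?thesis by simp
  next
    case False
    then obtain l where "k - int (card P) = int l"
      by (metis diff_ge_0_iff_ge not_less nonneg_int_cases)
    then have l: "k = int (card P) + int l" by simp
    have "bij_betw (\<lambda>X. P \<union> X) {X. X \<subseteq> {Suc a..n} \<and> card X = l} (slice n a P k)"
    proof (rule bij_betw_byWitness[where f' = "\<lambda>F. F \<inter> {Suc a..n}"])
      show "\<forall>X\<in>{X. X \<subseteq> {Suc a..n} \<and> card X = l}. (P \<union> X) \<inter> {Suc a..n} = X"
        using assms by fastforce
      show "\<forall>F\<in>slice n a P k. P \<union> F \<inter> {Suc a..n} = F"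
        unfolding slice_def by (auto simp: not_less_eq_eq)
      show "(\<lambda>X. P \<union> X) ` {X. X \<subseteq> {Suc a..n} \<and> card X = l} \<subseteq> slice n a P k"
      proof clarify
        fix X assume X: "X \<subseteq> {Suc a..n}" "l = card X"
        have "P \<inter> X = {}" "finite X" using X assms by (fastforce, auto intro: finite_subset)
        then have "card (P \<union> X) = card P + card X"
          using finP by (simp add: card_Un_disjoint)
        moreover have "(P \<union> X) \<inter> {1..a} = P" "P \<union> X \<subseteq> {1..n}"
          using X assms by fastforce+
        ultimately show "P \<union> X \<in> slice n a P k"
          using l X by (simp add: slice_def)
      qed
      show "(\<lambda>F. F \<inter> {Suc a..n}) ` slice n a P k \<subseteq> {X. X \<subseteq> {Suc a..n} \<and> card X = l}"
      proof clarify
        fix F assume F: "F \<in> slice n a P k"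
        then have "F = P \<union> F \<inter> {Suc a..n}"
          unfolding slice_def by (auto simp: not_less_eq_eq)
        moreover have "P \<inter> (F \<inter> {Suc a..n}) = {}" using assms by fastforce
        ultimately have "card F = card P + card (F \<inter> {Suc a..n})"
          using finP by (metis card_Un_disjoint finite_Int finite_atLeastAtMost)
        with F l show "F \<inter> {Suc a..n} \<subseteq> {Suc a..n} \<and> card (F \<inter> {Suc a..n}) = l"
          by (auto simp: slice_def)
      qed
    qed
    then have "card (slice n a P k) = (n - a) choose l"
      using bij_betw_same_card n_subsets[of "{Suc a..n}" l] by fastforce
    then show ?thesis by (simp add: l)
  qed
qed

text \<open>The reflection principle for the walk \<open>height F\<close>.\<close>
lemma card_slice_hit:
  assumes P: "P \<subseteq> {1..a}" and start: "2 * int (card P) - int a \<le> r"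
    and "a \<le> n" and "2 * k - int n \<le> r"
  shows "int (card (slice_hit n a P k r)) \<le> ibinom (n - a) (k + int (card P) - int a - r)"
  using assms(3,4)
proof (induction n arbitrary: k rule: dec_induct)
  case base
  show ?case
  proof (cases "slice_hit a a P k r = {}")
    case False
    then obtain F where F: "F \<subseteq> {1..a}" "F \<inter> {1..a} = P" "int (card F) = k" "r \<le> height F a"
      by (auto simp: slice_hit_def slice_def)
    then have "F = P" by blast
    then have "k + int (card P) - int a - r = 0"
      using F height_full[OF F(1)] start base by simp
    moreover have "slice_hit a a P k r \<subseteq> {P}"
      by (auto simp: slice_hit_def slice_def)
    then have "card (slice_hit a a P k r) \<le> 1"
      using card_mono[of "{P}"] by simp
    ultimately show ?thesis by (simp add: ibinom_def)
  qed simp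
next
  case (step n)
  show ?case
  proof (cases "2 * k - int (Suc n) = r")
    \<comment> \<open>All walks of the slice end exactly at \<open>r\<close>, so all of them count,
      and the symmetry of binomial coefficients turns their number into the claimed one.\<close>
    case True
    have "int (card (slice_hit (Suc n) a P k r)) \<le> int (card (slice (Suc n) a P k))"
      by (intro of_nat_mono card_mono) (auto simp: slice_hit_def)
    also have "\<dots> = ibinom (Suc n - a) (k - int (card P))"
      using step.hyps P by (intro card_slice) auto
    also have "\<dots> = ibinom (Suc n - a) (k + int (card P) - int a - r)"
    proof -
      have "int (Suc n - a) - (k - int (card P)) = k + int (card P) - int a - r"
        using True step.hyps by linarith
      then show ?thesis using ibinom_symmetric by metis
    qed
    finally show ?thesis .
  next
    case False
    \<comment> \<open>The walk ends below \<open>r\<close>, so the hit occurs by time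
      \<open>n\<close>. Dropping the last step gives the two terms of Pascal's rule.\<close>
    have "slice_hit (Suc n) a P k r \<subseteq>
      slice_hit n a P k r \<union> insert (Suc n) ` slice_hit n a P (k - 1) r"
    proof
      fix F assume F: "F \<in> slice_hit (Suc n) a P k r"
      then have Fn: "F \<subseteq> {1..Suc n}" "F \<inter> {1..a} = P" "int (card F) = k"
        by (auto simp: slice_hit_def slice_def)
      obtain j where j: "j \<in> {a..Suc n}" "r \<le> height F j"
        using F by (auto simp: slice_hit_def)
      have "j \<noteq> Suc n"
        using j height_full[OF Fn(1)] Fn(3) False step.prems by auto
      with j have jn: "j \<in> {a..n}" by auto
      have cut: "(F - {Suc n}) \<inter> {1..i} = F \<inter> {1..i}" if "i \<le> n" for i
        using that by auto
      have G: "F - {Suc n} \<subseteq> {1..n}" "(F - {Suc n}) \<inter> {1..a} = P"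
        "r \<le> height (F - {Suc n}) j"
        using Fn j(2) jn cut step.hyps by (auto simp: height_def le_Suc_eq)
      show "F \<in> slice_hit n a P k r \<union> insert (Suc n) ` slice_hit n a P (k - 1) r"
      proof (cases "Suc n \<in> F")
        case True
        have "card F = Suc (card (F - {Suc n}))"
          using True Fn(1) by (meson card.remove finite_atLeastAtMost finite_subset card_Suc_Diff1)
        then have "F - {Suc n} \<in> slice_hit n a P (k - 1) r"
          using G Fn jn unfolding slice_hit_def slice_def by auto
        moreover have "F = insert (Suc n) (F - {Suc n})" using True by auto
        ultimately show ?thesis by blast
      next
        case nF: False
        then have "F - {Suc n} = F" by simp
        with G Fn jn show ?thesis unfolding slice_hit_def slice_def by auto
      qed
    qed
    then have "card (slice_hit (Suc n) a P k r) \<le>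
      card (slice_hit n a P k r \<union> insert (Suc n) ` slice_hit n a P (k - 1) r)"
      by (intro card_mono) auto
    also have "\<dots> \<le> card (slice_hit n a P k r) + card (slice_hit n a P (k - 1) r)"
      by (meson card_Un_le card_image_le finite_slice_hit add_left_mono le_trans)
    finally have "int (card (slice_hit (Suc n) a P k r)) \<le>
      int (card (slice_hit n a P k r)) + int (card (slice_hit n a P (k - 1) r))"
      by linarith
    also have "\<dots> \<le> ibinom (n - a) (k + int (card P) - int a - r) +
      ibinom (n - a) (k - 1 + int (card P) - int a - r)"
      using step.prems False by (intro add_mono step.IH) auto
    also have "\<dots> = ibinom (Suc n - a) (k + int (card P) - int a - r)"
      using step.hyps by (simp add: Suc_diff_le ibinom_Suc algebra_simps)
    finally show ?thesis .
  qed
qed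

section \<open>Counting by the size of a prefix\<close>

lemma card_prefix_classes:
  assumes "finite X"
    and "\<And>P. P \<subseteq> {1..a} \<Longrightarrow> card P = p \<Longrightarrow> int (card {F \<in> X. F \<inter> {1..a} = P}) \<le> N"
  shows "int (card {F \<in> X. card (F \<inter> {1..a}) = p}) \<le> int (a choose p) * N"
proof -
  let ?I = "{P. P \<subseteq> {1..a} \<and> card P = p}"
  have "{F \<in> X. card (F \<inter> {1..a}) = p} = (\<Union>P\<in>?I. {F \<in> X. F \<inter> {1..a} = P})"
    by auto
  then have "card {F \<in> X. card (F \<inter> {1..a}) = p} \<le> (\<Sum>P\<in>?I. card {F \<in> X. F \<inter> {1..a} = P})"
    using card_UN_le[of ?I "\<lambda>P. {F \<in> X. F \<inter> {1..a} = P}"] by simp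
  then have "int (card {F \<in> X. card (F \<inter> {1..a}) = p})
      \<le> (\<Sum>P\<in>?I. int (card {F \<in> X. F \<inter> {1..a} = P}))"
    using of_nat_mono by (simp only: of_nat_sum[symmetric])
  also have "\<dots> \<le> (\<Sum>P\<in>?I. N)"
    using assms(2) by (intro sum_mono) auto
  also have "\<dots> = int (a choose p) * N"
    using n_subsets[of "{1..a}" p] by simp
  finally show ?thesis .
qed

lemma card_all_classes:
  assumes "X \<subseteq> {F. F \<subseteq> {1..n} \<and> int (card F) = k}" and "a \<le> n"
  shows "int (card {F \<in> X. card (F \<inter> {1..a}) = p})
    \<le> int (a choose p) * ibinom (n - a) (k - int p)"
proof (rule card_prefix_classes)
  show "finite X" by (rule finite_subset[of _ "Pow {1..n}"]) (use assms(1) in auto)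
next
  fix P assume P: "P \<subseteq> {1..a}" "card P = p"
  have "{F \<in> X. F \<inter> {1..a} = P} \<subseteq> slice n a P k"
    using assms(1) by (auto simp: slice_def)
  then have "card {F \<in> X. F \<inter> {1..a} = P} \<le> card (slice n a P k)"
    by (simp add: card_mono)
  with card_slice[OF P(1) \<open>a \<le> n\<close>, of k] P(2)
  show "int (card {F \<in> X. F \<inter> {1..a} = P}) \<le> ibinom (n - a) (k - int p)" by simp
qed

lemma card_hit_classes:
  assumes "X \<subseteq> {F. F \<subseteq> {1..n} \<and> int (card F) = k}" and "a \<le> n"
    and "\<And>F. F \<in> X \<Longrightarrow> card (F \<inter> {1..a}) = p \<Longrightarrow> \<exists>j\<in>{a..n}. r \<le> height F j"
    and "2 * int p - int a \<le> r" and "2 * k - int n \<le> r"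
  shows "int (card {F \<in> X. card (F \<inter> {1..a}) = p})
    \<le> int (a choose p) * ibinom (n - a) (k + int p - int a - r)"
proof (rule card_prefix_classes)
  show "finite X" by (rule finite_subset[of _ "Pow {1..n}"]) (use assms(1) in auto)
next
  fix P assume P: "P \<subseteq> {1..a}" "card P = p"
  have "{F \<in> X. F \<inter> {1..a} = P} \<subseteq> slice_hit n a P k r"
    using assms(1,3) P by (auto simp: slice_hit_def slice_def)
  then have "card {F \<in> X. F \<inter> {1..a} = P} \<le> card (slice_hit n a P k r)"
    by (simp add: card_mono)
  with card_slice_hit[OF P(1), of r n k] assms(2,4,5) P(2)
  show "int (card {F \<in> X. F \<inter> {1..a} = P}) \<le> ibinom (n - a) (k + int p - int a - r)" by simp
qed

text \<open>The upper bound for hits becomes a lower bound for the walks that stay below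
  \<open>r\<close>. These will be the sets shown to be absent from the family.\<close>

lemma card_slice_miss:
  assumes "P \<subseteq> {1..a}" "a \<le> n" "2 * int (card P) - int a \<le> r" "2 * k - int n \<le> r"
  shows "ibinom (n - a) (k - int (card P)) - ibinom (n - a) (k + int (card P) - int a - r)
    \<le> int (card (slice n a P k - slice_hit n a P k r))"
proof -
  have sub: "slice_hit n a P k r \<subseteq> slice n a P k" by (auto simp: slice_hit_def)
  then have "int (card (slice n a P k - slice_hit n a P k r))
      = int (card (slice n a P k)) - int (card (slice_hit n a P k r))"
    by (simp add: card_Diff_subset card_mono of_nat_diff)
  with card_slice[OF assms(1,2), of k] card_slice_hit[OF assms(1,3,2,4)] show ?thesis by linarith
qed

lemma height_missing_le:
  assumes "x \<notin> F" "1 \<le> x" "x \<le> j"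
  shows "height F j \<le> int j - 2"
proof -
  have "x \<in> {1..j}" using assms by simp
  then have "F \<inter> {1..j} \<subset> {1..j}" using assms by blast
  then have "card (F \<inter> {1..j}) < j"
    by (metis card_atLeastAtMost diff_Suc_1 finite_atLeastAtMost psubset_card_mono)
  then show ?thesis by (simp add: height_def)
qed

section \<open>Shifting\<close>

text \<open>The condition \<open>1 \<le> i\<close> prevents an exchange from inserting 0, which is
  outside the ground set.\<close>

definition shifted :: "nat set set \<Rightarrow> bool" where
  "shifted A \<longleftrightarrow> (\<forall>F\<in>A. \<forall>i j. 1 \<le> i \<and> i < j \<and> j \<in> F \<and> i \<notin> F \<longrightarrow> insert i (F - {j}) \<in> A)"

text \<open>The Erdos-Ko-Rado compression, acting on one member of \<open>A\<close>.\<close>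

definition shift_set :: "nat \<Rightarrow> nat \<Rightarrow> nat set set \<Rightarrow> nat set \<Rightarrow> nat set" where
  "shift_set i j A F =
    (if j \<in> F \<and> i \<notin> F \<and> insert i (F - {j}) \<notin> A then insert i (F - {j}) else F)"

text \<open>Moved sets land outside \<open>A\<close> and kept sets stay inside, so no moved image
  equals a kept one; the exchange itself is invertible.\<close>

lemma inj_on_shift_set:
  assumes "i \<noteq> j"
  shows "inj_on (shift_set i j A) A"
proof (rule inj_onI)
  fix F G assume FG: "F \<in> A" "G \<in> A" and eq: "shift_set i j A F = shift_set i j A G"
  have inv: "insert j (insert i (H - {j}) - {i}) = H" if "j \<in> H" "i \<notin> H" for H
    using that assms by auto
  have fixed_or_moved: "shift_set i j A H = H \<or>
      j \<in> H \<and> i \<notin> H \<and> shift_set i j A H = insert i (H - {j}) \<and> shift_set i j A H \<notin> A" for H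
    by (simp add: shift_set_def)
  consider "shift_set i j A F = F" "shift_set i j A G = G"
    | "shift_set i j A F \<notin> A" "shift_set i j A G = G"
    | "shift_set i j A F = F" "shift_set i j A G \<notin> A"
    | "j \<in> F" "i \<notin> F" "shift_set i j A F = insert i (F - {j})"
      "j \<in> G" "i \<notin> G" "shift_set i j A G = insert i (G - {j})"
    using fixed_or_moved[of F] fixed_or_moved[of G] by blast
  then show "F = G"
  proof cases
    case 1
    with eq show ?thesis by (simp only:)
  next
    case 2
    with eq FG(2) show ?thesis by metis
  next
    case 3
    with eq FG(1) show ?thesis by metis
  next
    case 4
    then have "insert i (F - {j}) = insert i (G - {j})" using eq by simp
    then show ?thesis using inv[of F] inv[of G] 4 by simp
  qed
qed

lemma card_move:
  assumes "finite F" "j \<in> F" "i \<notin> F"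
  shows "card (insert i (F - {j})) = card F"
  using assms by (metis DiffE card.insert card.remove finite_Diff)

lemma card_shift_set: "finite F \<Longrightarrow> card (shift_set i j A F) = card F"
  by (auto simp: shift_set_def simp del: card_insert_if card_insert_disjoint intro!: card_move)

text \<open>The delicate case is a moved \<open>F\<close> and a kept \<open>G\<close> with
  \<open>j \<in> G\<close>, \<open>i \<notin> G\<close>. Then \<open>G\<close> was kept because its
  exchange is already in \<open>A\<close>, and the new union equals the union of the old
  \<open>F\<close> with that exchange.\<close>

lemma union_bounded_shift:
  assumes ub: "union_bounded u A" and fin: "\<And>F. F \<in> A \<Longrightarrow> finite F" and "i \<noteq> j"
  shows "union_bounded u (shift_set i j A ` A)"
proof -
  let ?m = "\<lambda>F. insert i (F - {j})"
  let ?moved = "\<lambda>F. j \<in> F \<and> i \<notin> F \<and> ?m F \<notin> A"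
  have moved: "shift_set i j A F = ?m F" if "?moved F" for F
    using that unfolding shift_set_def by (rule if_P)
  have kept: "shift_set i j A F = F" if "\<not> ?moved F" for F
    using that unfolding shift_set_def by (rule if_not_P)
  have both: "card (F \<union> G) \<le> u" if "F \<in> A" "G \<in> A" for F G
    using ub that by (auto simp: union_bounded_def)
  have one: "card (?m F \<union> G) \<le> u" if FG: "F \<in> A" "G \<in> A" and F: "?moved F" and G: "\<not> ?moved G" for F G
  proof -
    consider "i \<in> G" | "i \<notin> G" "j \<notin> G" | "i \<notin> G" "j \<in> G" "?m G \<in> A" using G by blast
    then show ?thesis
    proof cases
      case 1
      then have "card (?m F \<union> G) \<le> card (F \<union> G)"
        using fin FG by (intro card_mono) auto
      with both[OF FG] show ?thesis by simp
    next
      case 2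
      then have "?m F \<union> G = ?m (F \<union> G)" by auto
      then have "card (?m F \<union> G) = card (F \<union> G)"
        using card_move[of "F \<union> G" j i] fin FG F 2 by simp
      with both[OF FG] show ?thesis by simp
    next
      case 3
      then have "?m F \<union> G = F \<union> ?m G" using F by auto
      with both[OF FG(1) 3(3)] show ?thesis by simp
    qed
  qed
  have "card (shift_set i j A F \<union> shift_set i j A G) \<le> u" if FG: "F \<in> A" "G \<in> A" for F G
  proof (cases "?moved F"; cases "?moved G")
    assume m: "?moved F" "?moved G"
    have "?m F \<union> ?m G = ?m (F \<union> G)" by auto
    then have "card (?m F \<union> ?m G) = card (F \<union> G)"
      using card_move[of "F \<union> G" j i] fin FG m by simp
    with both[OF FG] show ?thesis unfolding moved[OF m(1)] moved[OF m(2)] by simp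
  next
    assume m: "?moved F" "\<not> ?moved G"
    show ?thesis unfolding moved[OF m(1)] kept[OF m(2)] by (rule one[OF FG m])
  next
    assume m: "\<not> ?moved F" "?moved G"
    show ?thesis unfolding kept[OF m(1)] moved[OF m(2)] Un_commute[of F]
      by (rule one[OF FG(2,1) m(2,1)])
  next
    assume m: "\<not> ?moved F" "\<not> ?moved G"
    show ?thesis unfolding kept[OF m(1)] kept[OF m(2)] by (rule both[OF FG])
  qed
  then show ?thesis by (auto simp: union_bounded_def)
qed

text \<open>Among the families with the required properties take one with the least total of all
  elements; an exchange leading out of it would allow a shift that lowers this total.\<close>

lemma exists_shifted:
  assumes "A \<subseteq> Pow {1..n}" "\<And>F. F \<in> A \<Longrightarrow> m \<le> card F" "union_bounded u A"
  obtains B where "B \<subseteq> Pow {1..n}" "\<And>F. F \<in> B \<Longrightarrow> m \<le> card F" "union_bounded u B"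
    "card B = card A" "shifted B"
proof -
  define good where "good B \<longleftrightarrow> B \<subseteq> Pow {1..n} \<and> (\<forall>F\<in>B. m \<le> card F) \<and> union_bounded u B
    \<and> card B = card A" for B
  define weight where "weight B = (\<Sum>F\<in>B. \<Sum>F)" for B :: "nat set set"
  have "good A" using assms by (simp add: good_def)
  then obtain B where B: "good B" and min: "\<And>C. good C \<Longrightarrow> weight B \<le> weight C"
    using ex_has_least_nat[of good A weight] by auto
  have finB: "finite B" and finF: "\<And>F. F \<in> B \<Longrightarrow> finite F"
    using B by (auto simp: good_def intro: finite_subset)
  have "insert i (F - {j}) \<in> B" if F: "F \<in> B" and ij: "1 \<le> i" "i < j" "j \<in> F" "i \<notin> F" for F i j
  proof (rule ccontr)
    assume notin: "insert i (F - {j}) \<notin> B"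
    let ?\<phi> = "shift_set i j B"
    have "F \<subseteq> {1..n}" using B F by (auto simp: good_def)
    with ij have j: "j \<le> n" by auto
    have "?\<phi> ` B \<subseteq> Pow {1..n}"
    proof clarify
      fix G x assume "G \<in> B" "x \<in> ?\<phi> G"
      with B have "G \<subseteq> {1..n}" by (auto simp: good_def)
      with \<open>x \<in> ?\<phi> G\<close> ij j show "x \<in> {1..n}" by (auto simp: shift_set_def split: if_splits)
    qed
    moreover have "card (?\<phi> ` B) = card B"
      using ij by (intro card_image inj_on_shift_set) simp
    moreover have "union_bounded u (?\<phi> ` B)"
      using B finF ij by (intro union_bounded_shift) (auto simp: good_def)
    moreover have "m \<le> card (?\<phi> G)" if "G \<in> B" for G
      using that B finF by (simp add: card_shift_set good_def)
    ultimately have "good (?\<phi> ` B)" using B by (auto simp: good_def)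
    moreover have "weight (?\<phi> ` B) < weight B"
    proof -
      have less: "\<Sum>(insert i (G - {j})) < \<Sum>G" if "G \<in> B" "j \<in> G" "i \<notin> G" for G
        using that finF[of G] ij by (simp add: sum.remove)
      have "weight (?\<phi> ` B) = (\<Sum>G\<in>B. \<Sum>(?\<phi> G))"
        unfolding weight_def using ij by (subst sum.reindex) (auto intro: inj_on_shift_set)
      also have "\<dots> < (\<Sum>G\<in>B. \<Sum>G)"
      proof (rule sum_strict_mono_ex1[OF finB])
        show "\<forall>G\<in>B. \<Sum>(?\<phi> G) \<le> \<Sum>G"
          using less by (auto simp: shift_set_def intro: less_imp_le)
        show "\<exists>G\<in>B. \<Sum>(?\<phi> G) < \<Sum>G"
          using less[OF F ij(3,4)] F ij notin by (auto simp: shift_set_def intro!: bexI[of _ F])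
      qed
      finally show ?thesis by (simp add: weight_def)
    qed
    ultimately show False using min by fastforce
  qed
  then have "shifted B" by (auto simp: shifted_def)
  with B show ?thesis by (intro that[of B]) (auto simp: good_def)
qed

text \<open>In a pair violating the bound, take \<open>x \<in> F \<inter> G\<close> least such that \<open>F \<inter> G\<close> has \<open>|F| + |G| - u\<close>
  elements up to \<open>x\<close>. Some \<open>y < x\<close> then lies outside \<open>F \<union> G\<close>, and exchanging \<open>x\<close> for \<open>y\<close> in
  \<open>G\<close> gives another violating pair with a smaller intersection.\<close>
lemma shifted_meet_counts:
  assumes sh: "shifted A" and A: "A \<subseteq> Pow {1..n}" and ub: "union_bounded u A"
    and "F \<in> A" "G \<in> A"
  shows "\<exists>j\<le>n. int j + int (card F) + int (card G) - int u
    \<le> int (card (F \<inter> {1..j})) + int (card (G \<inter> {1..j}))"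
  using \<open>G \<in> A\<close>
proof (induction "card (F \<inter> G)" arbitrary: G rule: less_induct)
  case less
  define t where "t = int (card F) + int (card G) - int u"
  have fin: "finite F" "finite G" and Fn: "F \<subseteq> {1..n}" "G \<subseteq> {1..n}"
    using A \<open>F \<in> A\<close> less.prems by (auto intro: finite_subset)
  have "card (F \<union> G) \<le> u"
    using ub \<open>F \<in> A\<close> less.prems by (auto simp: union_bounded_def)
  then have tle: "t \<le> int (card (F \<inter> G))"
    using card_Un_Int[OF fin] unfolding t_def by linarith
  show ?case
  proof (rule ccontr)
    assume "\<not> ?thesis"
    then have neg: "int (card (F \<inter> {1..j})) + int (card (G \<inter> {1..j})) < int j + t" if "j \<le> n" for j
      using that unfolding t_def by force
    have "0 < t" using neg[of 0] by simp
    let ?c = "\<lambda>x. int (card (F \<inter> G \<inter> {1..x}))"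
    define x where "x = (LEAST x. t \<le> ?c x)"
    have "t \<le> ?c n" using tle Fn by (metis Int_absorb2 le_infI1)
    then have xt: "t \<le> ?c x" and xn: "x \<le> n"
      unfolding x_def by (rule LeastI, rule Least_le)
    have before: "?c y < t" if "y < x" for y
      using not_less_Least[of y "\<lambda>x. t \<le> ?c x"] that unfolding x_def by auto
    have "x \<noteq> 0"
    proof
      assume "x = 0"
      with xt \<open>0 < t\<close> show False by simp
    qed
    then obtain w where w: "x = Suc w" using not0_implies_Suc by blast
    have step: "F \<inter> G \<inter> {1..x} =
        (if x \<in> F \<inter> G then insert x (F \<inter> G \<inter> {1..w}) else F \<inter> G \<inter> {1..w})"
      unfolding w by (auto simp: le_Suc_eq)
    have wlt: "?c w < t" using before w by simp
    have xFG: "x \<in> F" "x \<in> G" using step xt wlt by (auto split: if_splits)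
    have "?c x = ?c w + 1" using step xFG fin w by simp
    then have cx: "?c x = t" using xt wlt by linarith
    have incl: "int (card (F \<inter> {1..y})) + int (card (G \<inter> {1..y}))
        = int (card ((F \<union> G) \<inter> {1..y})) + ?c y" for y
    proof -
      have "F \<inter> {1..y} \<union> G \<inter> {1..y} = (F \<union> G) \<inter> {1..y}"
        "(F \<inter> {1..y}) \<inter> (G \<inter> {1..y}) = F \<inter> G \<inter> {1..y}" by auto
      then show ?thesis
        using card_Un_Int[of "F \<inter> {1..y}" "G \<inter> {1..y}"] by simp
    qed
    have "card ((F \<union> G) \<inter> {1..x}) < x"
      using incl[of x] cx neg[OF xn] by linarith
    then have "\<not> {1..x} \<subseteq> F \<union> G"
      by (metis Int_absorb1 card_atLeastAtMost diff_Suc_1 less_irrefl)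
    then obtain y where "y \<in> {1..x}" "y \<notin> F \<union> G" by blast
    then have y: "1 \<le> y" "y \<le> x" "y \<notin> F" "y \<notin> G" by auto
    with xFG have "y < x" by (metis le_neq_implies_less)
    define G' where "G' = insert y (G - {x})"
    have G': "G' \<in> A"
      using sh less.prems y \<open>y < x\<close> xFG unfolding shifted_def G'_def by blast
    have "F \<inter> G' = F \<inter> G - {x}" using y by (auto simp: G'_def)
    then have smaller: "card (F \<inter> G') < card (F \<inter> G)"
      using xFG fin by (metis IntI card_Diff1_less finite_Int)
    have cG': "card G' = card G"
      unfolding G'_def using fin xFG y by (metis DiffE card.insert card.remove finite_Diff)
    obtain j where j: "j \<le> n" and
      jle: "int j + t \<le> int (card (F \<inter> {1..j})) + int (card (G' \<inter> {1..j}))"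
      using less.hyps[OF smaller G'] cG' unfolding t_def by force
    consider "j < y" | "y \<le> j" "j < x" | "x \<le> j" by linarith
    then show False
    proof cases
      case 1
      then have "G' \<inter> {1..j} = G \<inter> {1..j}" using \<open>y < x\<close> by (auto simp: G'_def)
      with neg[OF j] jle show False by simp
    next
      \<comment> \<open>Here \<open>G'\<close> has gained one element over \<open>G\<close>, but
        both terms in \<open>incl\<close> fall short by at least one: \<open>y\<close> is missing
        from the union, and \<open>x\<close> is not reached yet.\<close>
      case 2
      then have "G' \<inter> {1..j} = insert y (G \<inter> {1..j})" using y by (auto simp: G'_def)
      then have c: "card (G' \<inter> {1..j}) = Suc (card (G \<inter> {1..j}))" using y by simp
      have "y \<in> {1..j}" using y 2 by simp
      then have "(F \<union> G) \<inter> {1..j} \<subset> {1..j}" using y by blast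
      then have "card ((F \<union> G) \<inter> {1..j}) < j"
        by (metis card_atLeastAtMost diff_Suc_1 finite_atLeastAtMost psubset_card_mono)
      with incl[of j] before[OF 2(2)] jle c show False by linarith
    next
      case 3
      then have "G' \<inter> {1..j} = insert y (G \<inter> {1..j} - {x})" using y by (auto simp: G'_def)
      then have "card (G' \<inter> {1..j}) = card (G \<inter> {1..j})"
        using y xFG 3 \<open>x \<noteq> 0\<close> card_Suc_Diff1[of "G \<inter> {1..j}" x] by simp
      with neg[OF j] jle show False by simp
    qed
  qed
qed

section \<open>Shifted union families\<close>

locale shifted_union_family =
  fixes n d :: nat and A :: "nat set set"
  assumes d_pos: "0 < d" and large: "6 * d \<le> n"
    and subset: "A \<subseteq> Pow {1..n}"
    and size: "F \<in> A \<Longrightarrow> d + 1 \<le> card F"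
    and bounded: "union_bounded (2 * d) A"
    and shifted: "shifted A"
begin

definition level :: "nat \<Rightarrow> nat set set" where
  "level i = {F \<in> A. card F = d + i}"

lemma finite_A [simp]: "finite A"
  using subset by (rule finite_subset) simp

lemma finite_level [simp]: "finite (level i)"
  by (simp add: level_def)

lemma level_subset: "level i \<subseteq> {F. F \<subseteq> {1..n} \<and> int (card F) = int d + int i}"
  using subset by (auto simp: level_def)

text \<open>The excess \<open>|F| + |G| - 2d\<close> is \<open>i + k\<close>; doubling the counts
  and subtracting \<open>2j\<close> turns them into heights.\<close>

lemma levels_meet:
  assumes "F \<in> level i" "G \<in> level k"
  obtains j where "j \<le> n" "2 * (int i + int k) \<le> height F j + height G j"
proof -
  have FG: "F \<in> A" "G \<in> A" "card F = d + i" "card G = d + k"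
    using assms by (auto simp: level_def)
  obtain j where "j \<le> n" "int j + int (card F) + int (card G) - int (2 * d)
      \<le> int (card (F \<inter> {1..j})) + int (card (G \<inter> {1..j}))"
    using shifted_meet_counts[OF shifted subset bounded FG(1,2)] by blast
  with FG(3,4) show ?thesis by (intro that[of j]) (auto simp: height_def)
qed

lemma card_by_levels:
  "int (card A) \<le> int (card (level 1)) + int (\<Sum>i<n. card (level (i + 2)))"
proof -
  have "A \<subseteq> level 1 \<union> (\<Union>i<n. level (i + 2))"
  proof
    fix F assume F: "F \<in> A"
    then have "F \<subseteq> {1..n}" using subset by blast
    then have cF: "card F \<le> n" using card_mono[of "{1..n}" F] by simp
    obtain e where e: "card F = d + 1 + e" using size[OF F] le_Suc_ex by blast
    show "F \<in> level 1 \<union> (\<Union>i<n. level (i + 2))"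
    proof (cases e)
      case 0
      with F e show ?thesis by (simp add: level_def)
    next
      case (Suc i)
      then have "F \<in> level (i + 2)" "i < n" using F e cF by (auto simp: level_def)
      then show ?thesis by blast
    qed
  qed
  then have "card A \<le> card (level 1 \<union> (\<Union>i<n. level (i + 2)))"
    by (intro card_mono) auto
  also have "\<dots> \<le> card (level 1) + card (\<Union>i<n. level (i + 2))"
    by (rule card_Un_le)
  also have "\<dots> \<le> card (level 1) + (\<Sum>i<n. card (level (i + 2)))"
    by (intro add_left_mono card_UN_le) simp
  finally show ?thesis by linarith
qed

text \<open>Here \<open>r\<close> is the height gained beyond \<open>2i\<close>. Reflection gives
  size \<open>d + i\<close> the lower index \<open>d - i - r\<close>, so the bounds for the sizes
  from \<open>d + 2\<close> on form a geometric series.\<close>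

lemma card_upper_levels:
  assumes "0 \<le> r"
    and hit: "\<And>i F. 2 \<le> i \<Longrightarrow> F \<in> level i \<Longrightarrow> \<exists>j\<le>n. 2 * int i + r \<le> height F j"
  shows "4 * int (\<Sum>i<n. card (level (i + 2))) \<le> 5 * ibinom n (int d - 2 - r)"
proof -
  have "int (card (level (i + 2))) \<le> ibinom n (int d - 2 - r - int i)" for i
  proof -
    \<comment> \<open>The prefix of length 0 restricts nothing, so this class is the whole
      level.\<close>
    have "int (card {F \<in> level (i + 2). card (F \<inter> {1..0}) = 0}) \<le> int (0 choose 0) *
      ibinom (n - 0) (int d + int (i + 2) + int 0 - int 0 - (2 * int (i + 2) + r))"
    proof (rule card_hit_classes[OF level_subset])
      fix F assume "F \<in> level (i + 2)"
      then show "\<exists>j\<in>{0..n}. 2 * int (i + 2) + r \<le> height F j"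
        using hit[of "i + 2" F] by auto
    qed (use assms(1) large in auto)
    then show ?thesis by (simp add: algebra_simps)
  qed
  then have "int (\<Sum>i<n. card (level (i + 2))) \<le> (\<Sum>i<n. ibinom n (int d - 2 - r - int i))"
    unfolding of_nat_sum by (intro sum_mono)
  moreover have "4 * (\<Sum>i<n. ibinom n (int d - 2 - r - int i)) \<le> 5 * ibinom n (int d - 2 - r)"
    using assms(1) large by (intro ibinom_sum_le) simp
  ultimately show ?thesis by linarith
qed

text \<open>Pairs \<open>F\<close> with itself. The summand 0 gives the shape of hypothesis
  \<open>hit\<close> in \<open>card_upper_levels\<close> at \<open>r = 0\<close>.\<close>

lemma level_hits_twice:
  assumes "F \<in> level i"
  shows "\<exists>j\<le>n. 2 * int i + 0 \<le> height F j"
proof -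
  obtain j where "j \<le> n" "2 * (int i + int i) \<le> height F j + height F j"
    using levels_meet[OF assms assms] .
  then show ?thesis by (intro exI[of _ j]) auto
qed

section \<open>Families with a sparse witness\<close>

text \<open>The existence of \<open>F\<close> forces \<open>s - 1\<close> as a level hit by the sets of \<open>level 1\<close> not containing
  \<open>{1, 2}\<close>; its failure at \<open>s + 1\<close> deprives the star of many sets.\<close>
definition sparse_witness :: "nat \<Rightarrow> bool" where
  "sparse_witness s \<longleftrightarrow>
    (\<exists>F\<in>level 1. F \<inter> {1..s} = {1, 2} \<and> (\<forall>j\<in>{s..n}. height F j \<le> 5 - int s))"

text \<open>The witness has height \<open>4 - j\<close> for \<open>2 \<le> j < s\<close> and at most
  \<open>5 - s\<close> from \<open>s\<close> on; the rest of \<open>2 * (1 + i)\<close> must come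
  from \<open>G\<close>.\<close>

lemma sparse_witness_meet:
  assumes "sparse_witness s" "2 \<le> s" "G \<in> level i" "1 \<le> i"
  obtains j where "2 \<le> j" "j < s" "2 * int i - 2 + int j \<le> height G j"
  | j where "j \<in> {s..n}" "2 * int i + int s - 3 \<le> height G j"
proof -
  obtain F where F: "F \<in> level 1" "F \<inter> {1..s} = {1, 2}"
    and low: "\<And>j. j \<in> {s..n} \<Longrightarrow> height F j \<le> 5 - int s"
    using assms(1) by (auto simp: sparse_witness_def)
  obtain j where j: "j \<le> n" "2 * (int 1 + int i) \<le> height F j + height G j"
    using levels_meet[OF F(1) assms(3)] .
  have "2 \<le> j"
    using j(2) height_bound[of F j] height_bound[of G j] assms(4) by simp
  show ?thesis
  proof (cases "j < s")
    case True
    have "F \<inter> {1..j} = (F \<inter> {1..s}) \<inter> {1..j}" using True by auto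
    also have "\<dots> = {1, 2}" using F(2) \<open>2 \<le> j\<close> by auto
    finally have "height F j = 4 - int j" by (simp add: height_def)
    with j(2) True \<open>2 \<le> j\<close> show ?thesis by (intro that(1)[of j]) auto
  next
    case False
    with j low[of j] show ?thesis by (intro that(2)[of j]) auto
  qed
qed

text \<open>For \<open>i \<ge> 2\<close> the first alternative of \<open>sparse_witness_meet\<close>
  would need a height above \<open>j\<close>, so the second always holds: a gain of
  \<open>s - 3\<close>.\<close>

lemma sparse_witness_upper_levels:
  assumes "sparse_witness s" "3 \<le> s"
  shows "4 * int (\<Sum>i<n. card (level (i + 2))) \<le> 5 * ibinom n (int d + 1 - int s)"
proof -
  have "4 * int (\<Sum>i<n. card (level (i + 2))) \<le> 5 * ibinom n (int d - 2 - (int s - 3))"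
  proof (rule card_upper_levels)
    fix i G assume i: "2 \<le> i" "G \<in> level i"
    then have "\<exists>j\<in>{s..n}. 2 * int i + int s - 3 \<le> height G j"
    proof (rule_tac sparse_witness_meet[OF assms(1) _ i(2)])
      fix j assume "2 * int i - 2 + int j \<le> height G j"
      with height_bound[of G j] i(1) show ?thesis by linarith
    qed (use assms(2) in auto)
    then show "\<exists>j\<le>n. 2 * int i + (int s - 3) \<le> height G j" by (auto simp: algebra_simps)
  qed (use assms(2) in auto)
  then show ?thesis by (simp add: algebra_simps)
qed

text \<open>Makes the star a prefix class, so that the counts by prefix size apply with
  \<open>a = 2\<close>.\<close>

lemma star_iff: "card (F \<inter> {1..2}) = 2 \<longleftrightarrow> {1, 2} \<subseteq> F" for F :: "nat set"
proof -
  have "{1..2} = {1, 2::nat}" by auto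
  then show ?thesis by (auto simp: Int_insert_right)
qed

text \<open>For \<open>i = 1\<close> the first alternative of \<open>sparse_witness_meet\<close>
  says that \<open>G\<close> contains all of \<open>{1..j}\<close> with \<open>j \<ge> 2\<close>,
  hence 1 and 2. All other sets hit \<open>s - 1\<close>; they have one of two singleton prefixes or
  the empty prefix in \<open>{1..2}\<close>.\<close>

lemma sparse_witness_non_star:
  assumes "sparse_witness s" "3 \<le> s"
  shows "int (card {G \<in> level 1. \<not> {1, 2} \<subseteq> G})
    \<le> 2 * ibinom (n - 2) (int d + 1 - int s) + ibinom (n - 2) (int d - int s)"
proof -
  let ?C = "\<lambda>p. {G \<in> level 1. card (G \<inter> {1..2}) = p}"
  have hit: "\<exists>j\<in>{2..n}. int s - 1 \<le> height G j" if G: "G \<in> level 1" "card (G \<inter> {1..2}) = p" "p < 2" for G p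
  proof -
    have "\<not> {1, 2} \<subseteq> G" using G(2,3) star_iff[of G] by (metis less_irrefl)
    then have "1 \<notin> G \<or> 2 \<notin> G" by simp
    then obtain x where x: "x \<notin> G" "1 \<le> x" "x \<le> 2"
      by (metis one_le_numeral order_refl)
    have "\<exists>j\<in>{s..n}. int s - 1 \<le> height G j"
    proof (rule sparse_witness_meet[OF assms(1) _ G(1)])
      fix j assume "2 \<le> j" "2 * int 1 - 2 + int j \<le> height G j"
      with height_missing_le[OF x(1,2), of j] x(3) show ?thesis by linarith
    qed (use assms(2) in auto)
    with assms(2) show ?thesis by auto
  qed
  have bound: "int (card (?C p)) \<le> int (2 choose p) *
      ibinom (n - 2) (int d + int 1 + int p - int 2 - (int s - 1))" if "p < 2" for p
    using hit that assms(2) large d_pos by (intro card_hit_classes[OF level_subset]) auto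
  have "{G \<in> level 1. \<not> {1, 2} \<subseteq> G} = ?C 1 \<union> ?C 0"
  proof -
    have "\<not> {1, 2} \<subseteq> G \<longleftrightarrow> card (G \<inter> {1..2}) = 1 \<or> card (G \<inter> {1..2}) = 0" for G :: "nat set"
    proof -
      have "card (G \<inter> {1..2}) \<le> 2"
        using card_mono[of "{1..2}" "G \<inter> {1..2}"] by simp
      then have "card (G \<inter> {1..2}) \<noteq> 2 \<longleftrightarrow> card (G \<inter> {1..2}) = 1 \<or> card (G \<inter> {1..2}) = 0"
        by linarith
      then show ?thesis by (simp only: star_iff)
    qed
    then show ?thesis by blast
  qed
  then have "card {G \<in> level 1. \<not> {1, 2} \<subseteq> G} \<le> card (?C 1) + card (?C 0)"
    by (metis (no_types, lifting) card_Un_le)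
  with bound[of 1] bound[of 0] show ?thesis by (simp add: algebra_simps)
qed

lemma card_star: "int (card {G \<in> level 1. {1, 2} \<subseteq> G}) \<le> ibinom (n - 2) (int d - 1)"
proof -
  have "int (card {G \<in> level 1. card (G \<inter> {1..2}) = 2})
      \<le> int (2 choose 2) * ibinom (n - 2) (int d + int 1 - int 2)"
    using large d_pos by (intro card_all_classes[OF level_subset]) simp
  then show ?thesis by (simp only: star_iff) simp
qed

text \<open>Every set that would be a witness for \<open>s\<close> belongs to the full star but not
  to the family; \<open>card_slice_miss\<close> counts these sets.\<close>

lemma card_star_without_witness:
  assumes "\<not> sparse_witness s" "2 \<le> s" "s \<le> d + 2"
  shows "int (card {G \<in> level 1. {1, 2} \<subseteq> G}) + ibinom (n - s) (int d - 1)
    \<le> ibinom (n - 2) (int d - 1) + ibinom (n - s) (int d - 3)"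
proof -
  let ?k = "int d + 1"
  \<comment> \<open>Missing the level \<open>6 - s\<close> means height at most
    \<open>5 - s\<close>, as in \<open>sparse_witness\<close>.\<close>
  let ?Y = "slice n s {1, 2} ?k - slice_hit n s {1, 2} ?k (6 - int s)"
  let ?S = "{G \<in> level 1. {1, 2} \<subseteq> G}"
  have sn: "s \<le> n" using assms(3) large d_pos by linarith
  have s: "{1, 2} \<subseteq> {1..s}" using assms(2) by auto
  have pre: "{1, 2} \<subseteq> {1..2::nat}" by auto
  have "?S \<inter> ?Y = {}"
  proof -
    have False if "F \<in> ?S" "F \<in> ?Y" for F
    proof -
      have "F \<inter> {1..s} = {1, 2}" "\<forall>j\<in>{s..n}. height F j \<le> 5 - int s"
        using that by (auto simp: slice_def slice_hit_def)
      with that assms(1) show False by (auto simp: sparse_witness_def)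
    qed
    then show ?thesis by blast
  qed
  moreover have "?S \<union> ?Y \<subseteq> slice n 2 {1, 2} ?k"
  proof
    fix F assume F: "F \<in> ?S \<union> ?Y"
    then have "F \<subseteq> {1..n}" "int (card F) = ?k"
      using level_subset[of 1] by (auto simp: slice_def)
    moreover have "{1, 2} \<subseteq> F" using F by (auto simp: slice_def)
    then have "F \<inter> {1..2} = {1, 2}" by auto
    ultimately show "F \<in> slice n 2 {1, 2} ?k" by (simp add: slice_def)
  qed
  then have "card (?S \<union> ?Y) \<le> card (slice n 2 {1, 2} ?k)"
    by (intro card_mono) auto
  moreover have "card (?S \<union> ?Y) = card ?S + card ?Y" if "?S \<inter> ?Y = {}"
    using that by (intro card_Un_disjoint) auto
  ultimately have "card ?S + card ?Y \<le> card (slice n 2 {1, 2} ?k)"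
    by simp
  moreover have "int (card (slice n 2 {1, 2} ?k)) = ibinom (n - 2) (int d - 1)"
    using card_slice[OF pre, of n ?k] assms sn by simp
  moreover have "ibinom (n - s) (int d - 1) - ibinom (n - s) (int d - 3) \<le> int (card ?Y)"
    using card_slice_miss[OF s sn, of "6 - int s" ?k] large d_pos assms(3)
    by simp
  ultimately show ?thesis by linarith
qed

lemma card_level_1_split:
  "int (card (level 1))
    = int (card {G \<in> level 1. {1, 2} \<subseteq> G}) + int (card {G \<in> level 1. \<not> {1, 2} \<subseteq> G})"
proof -
  have "card (level 1)
      = card ({G \<in> level 1. {1, 2} \<subseteq> G} \<union> {G \<in> level 1. \<not> {1, 2} \<subseteq> G})"
    by (rule arg_cong[of _ _ card]) blast
  also have "\<dots> = card {G \<in> level 1. {1, 2} \<subseteq> G} + card {G \<in> level 1. \<not> {1, 2} \<subseteq> G}"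
    by (intro card_Un_disjoint) auto
  finally show ?thesis by linarith
qed

text \<open>The star's loss at \<open>s + 1\<close> outweighs the non-star sets and the larger
  sizes, all multiplied by 4 to clear the \<open>5/4\<close>. Lowering the index by
  \<open>s - 2\<close> gains \<open>5 ^ (s - 2)\<close>, while shrinking the ground set by
  \<open>s - 1\<close> costs only \<open>(5/4) ^ (s - 1)\<close>.\<close>

lemma witness_arithmetic:
  assumes "4 \<le> s" "s \<le> d + 1"
  shows "4 * (2 * ibinom (n - 2) (int d + 1 - int s) + ibinom (n - 2) (int d - int s))
      + 5 * ibinom n (int d + 1 - int s) + 4 * ibinom (n - (s + 1)) (int d - 3)
    \<le> 4 * ibinom (n - (s + 1)) (int d - 1)"
proof -
  let ?b = "\<lambda>l. ibinom (n - 2) (int d + 1 - int s - l)"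
  let ?L = "ibinom (n - (s + 1))"
  obtain t where t: "s = t + 4" using assms(1) le_Suc_ex by (metis add.commute)
  have step: "5 * ?b (l + 1) \<le> ?b l" if "0 \<le> l" for l
    using ibinom_ratio[of 5 "int d + 1 - int s - l" "n - 2"] that assms large d_pos
    by (simp add: of_nat_diff algebra_simps)
  have n2: "ibinom n (int d + 1 - int s) = ?b 0 + 2 * ?b 1 + ?b 2"
    using ibinom_drop2[of n "int d + 1 - int s"] large d_pos by simp
  have low: "5 ^ (t + 2) * ?b 0 \<le> ibinom (n - 2) (int d - 1)"
    using ibinom_ratio_power[of "int d - 1" "n - 2" "t + 2"] large d_pos t
    by (simp add: of_nat_diff algebra_simps)
  have "n - (s + 1) + (t + 3) = n - 2" using t assms large d_pos by simp
  then have "4 ^ (t + 3) * ibinom (n - 2) (int d - 1) \<le> 5 ^ (t + 3) * ?L (int d - 1)"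
    using ibinom_upper_ratio_power[of "int d - 1" "n - (s + 1)" "t + 3"] assms large d_pos
    by (simp add: of_nat_diff)
  moreover have "4 ^ (t + 3) * (5 ^ (t + 2) * ?b 0) \<le> 4 ^ (t + 3) * ibinom (n - 2) (int d - 1)"
    using low by (intro mult_left_mono) auto
  ultimately have
    "4 ^ (t + 3) * (5 ^ (t + 2) * ?b 0) \<le> 5 ^ (t + 3) * ?L (int d - 1)"
    by linarith
  moreover have "5 ^ (t + 2) * (4 ^ (t + 3) * ?b 0) = 4 ^ (t + 3) * (5 ^ (t + 2) * ?b 0)"
    by (rule mult.left_commute)
  moreover have "5 ^ (t + 3) * ?L (int d - 1) = 5 ^ (t + 2) * (5 * ?L (int d - 1))"
    by (simp add: power_add)
  ultimately have "5 ^ (t + 2) * (4 ^ (t + 3) * ?b 0) \<le> 5 ^ (t + 2) * (5 * ?L (int d - 1))"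
    by linarith
  then have "4 ^ (t + 3) * ?b 0 \<le> 5 * ?L (int d - 1)"
    by (simp only: mult_le_cancel_left_pos zero_less_power zero_less_numeral)
  \<comment> \<open>This is \<open>4 ^ 3\<close>, the weakest case \<open>s = 4\<close>.\<close>
  moreover have "64 * ?b 0 \<le> 4 ^ (t + 3) * ?b 0"
    by (intro mult_right_mono) (auto simp: power_add)
  ultimately have gain: "64 * ?b 0 \<le> 5 * ?L (int d - 1)" by linarith
  have "4 * ?L (int d - 2) \<le> ?L (int d - 1)" "4 * ?L (int d - 3) \<le> ?L (int d - 2)"
    using ibinom_ratio[of 4 "int d - 1" "n - (s + 1)"] ibinom_ratio[of 4 "int d - 2" "n - (s + 1)"]
      assms large d_pos by (auto simp: of_nat_diff)
  moreover have "5 * ?b 1 \<le> ?b 0" "5 * ?b 2 \<le> ?b 1" using step[of 0] step[of 1] by auto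
  \<comment> \<open>The left side is at most \<open>16 * b0 + 4 * l3\<close>, hence at most
    \<open>3/2 * l1\<close>.\<close>
  moreover have "4 * (2 * b0 + b1) + 5 * (b0 + 2 * b1 + b2) + 4 * l3 \<le> 4 * l1"
    if "64 * b0 \<le> 5 * l1" "4 * l2 \<le> l1" "4 * l3 \<le> l2" "5 * b1 \<le> b0" "5 * b2 \<le> b1" "0 \<le> l3"
    for b0 b1 b2 l1 l2 l3 :: int
    using that by simp
  ultimately have "4 * (2 * ?b 0 + ?b 1) + 5 * (?b 0 + 2 * ?b 1 + ?b 2) + 4 * ?L (int d - 3)
      \<le> 4 * ?L (int d - 1)"
    using gain ibinom_nonneg by blast
  then show ?thesis unfolding n2 by (simp add: algebra_simps)
qed

text \<open>A witness with \<open>s \<ge> d + 2\<close> makes the lower indices negative, leaving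
  only the star. Otherwise a largest \<open>s\<close> exists, and the loss of the star at
  \<open>s + 1\<close> pays for everything else.\<close>

lemma card_le_with_witness:
  assumes "sparse_witness s" "4 \<le> s"
  shows "int (card A) \<le> ibinom (n - 2) (int d - 1)"
proof (cases "\<exists>s \<ge> d + 2. 4 \<le> s \<and> sparse_witness s")
  case True
  then obtain s where s: "d + 2 \<le> s" "4 \<le> s" "sparse_witness s" by blast
  then have "ibinom n (int d + 1 - int s) = 0" "ibinom (n - 2) (int d + 1 - int s) = 0"
    "ibinom (n - 2) (int d - int s) = 0" by simp_all
  with sparse_witness_upper_levels[OF s(3)] sparse_witness_non_star[OF s(3)] s(2)
  show ?thesis
    using card_star card_level_1_split card_by_levels by linarith
next
  case False
  then have bound: "\<forall>y. 4 \<le> y \<and> sparse_witness y \<longrightarrow> y < d + 2" by fastforce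
  obtain s where s: "4 \<le> s" "sparse_witness s"
    and max: "\<And>y. 4 \<le> y \<Longrightarrow> sparse_witness y \<Longrightarrow> y \<le> s"
    using ex_has_greatest_nat[OF _ bound, of s] assms by blast
  have sd: "s \<le> d + 1" using False s by fastforce
  have none: "\<not> sparse_witness (s + 1)" using max[of "s + 1"] s(1) by auto
  have ge: "3 \<le> s" "2 \<le> s + 1" "s + 1 \<le> d + 2" using s(1) sd by auto
  show ?thesis
    using sparse_witness_upper_levels[OF s(2) ge(1)] sparse_witness_non_star[OF s(2) ge(1)]
      card_star_without_witness[OF none ge(2,3)] witness_arithmetic[OF s(1) sd]
      card_level_1_split card_by_levels
    by (smt (verit))
qed

section \<open>Families without a sparse witness for 4\<close>

lemma card_level_1_by_prefix:
  "int (card (level 1)) \<le> (\<Sum>p\<le>4. int (card {F \<in> level 1. card (F \<inter> {1..4}) = p}))"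
proof -
  have "card (F \<inter> {1..4}) \<le> 4" for F :: "nat set"
    using card_mono[of "{1..4}" "F \<inter> {1..4}"] by simp
  then have "level 1 = (\<Union>p\<le>4. {F \<in> level 1. card (F \<inter> {1..4}) = p})"
    by auto
  then have "card (level 1) \<le> (\<Sum>p\<le>4. card {F \<in> level 1. card (F \<inter> {1..4}) = p})"
    using card_UN_le[of "{..4::nat}" "\<lambda>p. {F \<in> level 1. card (F \<inter> {1..4}) = p}"] by simp
  then show ?thesis using of_nat_mono by (simp only: of_nat_sum[symmetric])
qed

lemma height_steps:
  "height F 3 = height F 2 + (if 3 \<in> F then 1 else - 1)"
  "height F 4 = height F 3 + (if 4 \<in> F then 1 else - 1)"
  "height F 5 = height F 4 + (if 5 \<in> F then 1 else - 1)"
  "height F 6 = height F 5 + (if 6 \<in> F then 1 else - 1)"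
  using height_Suc[of F 2] height_Suc[of F 3] height_Suc[of F 4] height_Suc[of F 5]
  by (simp_all add: eval_nat_numeral)

text \<open>In the application \<open>tot\<close>, \<open>l\<close> and \<open>u\<close> count the
  family, its sets of size \<open>d + 1\<close> and its larger sets; \<open>k0\<close> to
  \<open>k4\<close> count the prefix classes in \<open>{1..4}\<close>; the \<open>c\<close> and
  \<open>e\<close> are coefficients over \<open>n - 4\<close> and \<open>n - 6\<close> elements. In
  the second part the loss \<open>2 * (e2 - e4)\<close> in \<open>k3\<close> makes up for the weaker
  bounds on \<open>k0\<close>, \<open>k1\<close>, \<open>k2\<close>.\<close>

lemma prefix_count_arithmetic:
  fixes tot l u c1 c2 c3 c4 c5 c6 k0 k1 k2 k3 k4 :: int
  assumes "tot \<le> l + u" "l \<le> k0 + k1 + k2 + k3 + k4"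
    and "4 * u \<le> 5 * (c2 + 4 * c3 + 6 * c4 + 4 * c5 + c6)"
    and "5 * c2 \<le> c1" "5 * c3 \<le> c2" "5 * c4 \<le> c3" "5 * c5 \<le> c4" "5 * c6 \<le> c5" "0 \<le> c2"
    and "k4 \<le> c3"
  shows prefix_count_low: "k0 \<le> c6 \<Longrightarrow> k1 \<le> 4 * c5 \<Longrightarrow> k2 \<le> 6 * c4 \<Longrightarrow> k3 \<le> 4 * c2
      \<Longrightarrow> tot \<le> c1 + 2 * c2 + c3"
    and prefix_count_gap: "k0 \<le> c5 \<Longrightarrow> k1 \<le> 4 * c4 \<Longrightarrow> k2 \<le> 6 * c3 \<Longrightarrow> k3 + 2 * (e2 - e4) \<le> 4 * c2
      \<Longrightarrow> c2 = e2 + 2 * e3 + e4 \<Longrightarrow> 5 * e3 \<le> e2 \<Longrightarrow> 5 * e4 \<le> e3 \<Longrightarrow> tot \<le> c1 + 2 * c2 + c3"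
  using assms by simp_all

lemma card_le_without_witness:
  assumes no_witness: "\<not> sparse_witness 4"
  shows "int (card A) \<le> ibinom (n - 2) (int d - 1)"
proof -
  let ?C = "\<lambda>p. {F \<in> level 1. card (F \<inter> {1..4}) = p}"
  let ?c = "\<lambda>l. ibinom (n - 4) (int d - l)"
  let ?e = "\<lambda>l. ibinom (n - 6) (int d - l)"
  have n6: "6 \<le> n" using large d_pos by linarith
  have C4: "int (card (?C 4)) \<le> ?c 3"
    using card_all_classes[OF level_subset, of 4 1 4] n6 by simp
  have C3: "int (card (?C 3)) \<le> 4 * ?c 2"
    using card_all_classes[OF level_subset, of 4 1 3] n6 by (simp add: eval_nat_numeral)
  have upper: "4 * int (\<Sum>i<n. card (level (i + 2))) \<le> 5 * ibinom n (int d - 2)"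
    using card_upper_levels[of 0] level_hits_twice by simp
  have split: "int (card (level 1)) \<le>
      int (card (?C 0)) + int (card (?C 1)) + int (card (?C 2)) + int (card (?C 3)) + int (card (?C 4))"
    using card_level_1_by_prefix by (simp add: eval_nat_numeral)
  have low_classes: "int (card (?C p)) \<le> int (4 choose p) * ?c (3 + r - int p)"
    if "p \<le> 2" "2 \<le> r" and "\<And>F. F \<in> ?C p \<Longrightarrow> \<exists>j\<in>{4..n}. r \<le> height F j" for p r
  proof -
    have "int (card (?C p)) \<le> int (4 choose p) *
        ibinom (n - 4) (int d + int 1 + int p - int 4 - r)"
      using that n6 large d_pos by (intro card_hit_classes[OF level_subset]) auto
    then show ?thesis by (simp add: algebra_simps)
  qed
  have c5: "5 * ?c (l + 1) \<le> ?c l" if "1 \<le> l" for l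
    using ibinom_ratio[of 5 "int d - l" "n - 4"] that n6 large by (simp add: of_nat_diff algebra_simps)
  have c_ratios: "5 * ?c 2 \<le> ?c 1" "5 * ?c 3 \<le> ?c 2" "5 * ?c 4 \<le> ?c 3" "5 * ?c 5 \<le> ?c 4"
    "5 * ?c 6 \<le> ?c 5"
    using c5[of 1] c5[of 2] c5[of 3] c5[of 4] c5[of 5] by auto
  \<comment> \<open>Everything is expanded over \<open>n - 4\<close> elements, so that the
    comparison becomes linear in the \<open>?c\<close>.\<close>
  have two: "ibinom (n - 2) (int d - l) = ?c l + 2 * ?c (l + 1) + ?c (l + 2)" for l
    using ibinom_drop2[of "n - 2" "int d - l"] n6 by (simp add: algebra_simps)
  have target: "ibinom (n - 2) (int d - 1) = ?c 1 + 2 * ?c 2 + ?c 3"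
    using two[of 1] by simp
  have top: "ibinom n (int d - 2) = ?c 2 + 4 * ?c 3 + 6 * ?c 4 + 4 * ?c 5 + ?c 6"
    using ibinom_drop2[of n "int d - 2"] two[of 2] two[of 3] two[of 4] n6 by simp
  show ?thesis
  proof (cases "\<forall>F\<in>level 1. card (F \<inter> {1..4}) \<le> 2 \<longrightarrow> (\<exists>j\<in>{4..n}. 3 \<le> height F j)")
    case True
    have "int (card (?C p)) \<le> int (4 choose p) * ?c (6 - int p)" if "p \<le> 2" for p
      using low_classes[of p 3] True that by auto
    from this[of 0] this[of 1] this[of 2]
    have "int (card (?C 0)) \<le> ?c 6" "int (card (?C 1)) \<le> 4 * ?c 5" "int (card (?C 2)) \<le> 6 * ?c 4"
      by (auto simp: choose_two)
    then show ?thesis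
      unfolding target using C3
      by (intro prefix_count_low[OF card_by_levels split upper[unfolded top] c_ratios ibinom_nonneg C4])
  next
    case False
    then obtain F where F: "F \<in> level 1" "card (F \<inter> {1..4}) \<le> 2"
      and low: "\<And>j. j \<in> {4..n} \<Longrightarrow> height F j \<le> 2" by force
    have height_2: "height G 2 \<le> 0" if "\<not> {1, 2} \<subseteq> G" for G
    proof -
      from that obtain x where "x \<notin> G" "1 \<le> x" "x \<le> (2::nat)" by fastforce
      then show ?thesis using height_missing_le[of x G 2] by simp
    qed
    \<comment> \<open>A set reaching level 2 only before time 4 starts with \<open>{1, 2}\<close>,
      skips 3 and 4 and stays at or below \<open>1 = 5 - 4\<close>, so it would be a witness for
      4.\<close>
    have hit2: "\<exists>j\<in>{4..n}. 2 \<le> height G j" if G: "G \<in> level 1" for G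
    proof (rule ccontr)
      assume "\<not> ?thesis"
      then have below: "height G j \<le> 1" if "j \<in> {4..n}" for j using that by force
      obtain j where j: "j \<le> n" "2 \<le> height G j" using level_hits_twice[OF G] by auto
      with below[of j] have "j < 4" by (cases "j < 4") auto
      with j height_bound[of G j] have "j = 2 \<or> j = 3" by auto
      moreover have h4: "height G 4 \<le> 1" using below n6 by simp
      moreover note height_steps(1,2)[of G]
      \<comment> \<open>Heights at odd times are odd. Height 3 at time 3 is excluded too, as it
        would leave at least 2 at time 4.\<close>
      moreover have "height G 3 \<noteq> 2" unfolding height_def by presburger
      moreover have "height G 2 \<le> 2" using height_bound[of G 2] by simp
      ultimately have "2 \<le> height G 2" "3 \<notin> G" "4 \<notin> G"
        using j(2) by (auto split: if_splits)
      moreover from this have "{1, 2} \<subseteq> G" using height_2 by fastforce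
      moreover have "{1..4} = {1, 2, 3, 4::nat}" by auto
      ultimately have "G \<inter> {1..4} = {1, 2}" by auto
      with G below no_witness show False by (auto simp: sparse_witness_def)
    qed
    have "int (card (?C p)) \<le> int (4 choose p) * ?c (5 - int p)" if "p \<le> 2" for p
      using low_classes[of p 2] hit2 that by auto
    from this[of 0] this[of 1] this[of 2]
    have C012: "int (card (?C 0)) \<le> ?c 5" "int (card (?C 1)) \<le> 4 * ?c 4" "int (card (?C 2)) \<le> 6 * ?c 3"
      by (auto simp: choose_two)
    let ?Y = "\<lambda>P. slice n 6 P (int d + 1) - slice_hit n 6 P (int d + 1) 2"
    \<comment> \<open>Prefixes \<open>{1, 3, 4}\<close> and \<open>{2, 3, 4}\<close> are the ones lacking an element of \<open>{1, 2}\<close>; such \<open>G\<close> must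
      hit 2 again after step 6 because \<open>F\<close> stays too low.\<close>
    have avoid: "G \<notin> ?Y {x, 3, 4}" if G: "G \<in> level 1" and x: "x \<in> {1, 2}" for G x
    proof
      assume "G \<in> ?Y {x, 3, 4}"
      then have G6: "G \<inter> {1..6} = {x, 3, 4}" and miss: "\<And>j. j \<in> {6..n} \<Longrightarrow> height G j \<le> 1"
        by (force simp: slice_def slice_hit_def)+
      obtain j where j: "j \<le> n" "4 \<le> height F j + height G j"
        using levels_meet[OF F(1) G] by auto
      have mem: "i \<in> G \<longleftrightarrow> i \<in> {x, 3, 4}" if "i \<in> {1..6}" for i
        using G6 that by blast
      have "\<not> {1, 2} \<subseteq> G" using mem[of 1] mem[of 2] x by auto
      then have g2: "height G 2 \<le> 0" by (rule height_2)
      have "3 \<in> G" "4 \<in> G" "5 \<notin> G" "6 \<notin> G"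
        using mem[of 3] mem[of 4] mem[of 5] mem[of 6] x by auto
      then have "height G 3 = height G 2 + 1" "height G 4 = height G 3 + 1"
        "height G 5 = height G 4 - 1" "height G 6 = height G 5 - 1"
        by (simp_all add: height_steps)
      with g2 have g: "height G 3 \<le> 1" "height G 4 \<le> 2" "height G 5 \<le> 1" "height G 6 \<le> 0"
        by linarith+
      have f4: "height F 4 \<le> 0" using F(2) by (simp add: height_def)
      have "height F 4 \<ge> height F 3 - 1" "height F 5 \<le> height F 4 + 1" "height F 6 \<le> height F 5 + 1"
        using height_steps[of F] by auto
      with f4 have f: "height F 3 \<le> 1" "height F 5 \<le> 1" "height F 6 \<le> 2"
        by linarith+
      \<comment> \<open>In every case the two heights sum to at most 3.\<close>
      consider "j \<le> 1" | "j = 2" | "j = 3" | "j = 4" | "j = 5" | "j = 6" | "7 \<le> j" by linarith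
      then show False
      proof cases
        case 1
        with j(2) height_bound[of F j] height_bound[of G j] show False by simp
      next
        case 2
        with j(2) height_bound[of F 2] g2 show False by simp
      next
        case 7
        with j low[of j] miss[of j] show False by simp
      qed (use j(2) f f4 g in simp_all)
    qed
    \<comment> \<open>Three elements in \<open>{1..6}\<close> leave \<open>d - 2\<close> to choose
      freely; reflection at 2 lowers this index to \<open>d - 4\<close>.\<close>
    have Y_card: "?e 2 - ?e 4 \<le> int (card (?Y {x, 3, 4}))" if "x \<in> {1, 2}" for x
      using card_slice_miss[of "{x, 3, 4}" 6 n 2 "int d + 1"] that n6 large d_pos by auto
    \<comment> \<open>Inside the full class of three-element prefixes, the family avoids two
      disjoint pieces, one for each \<open>x\<close>.\<close>
    have C3': "int (card (?C 3)) + 2 * (?e 2 - ?e 4) \<le> 4 * ?c 2"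
    proof -
      let ?U = "{F. F \<subseteq> {1..n} \<and> int (card F) = int d + 1}"
      let ?X = "{F \<in> ?U. card (F \<inter> {1..4}) = 3}"
      have finX: "finite ?X" by (rule finite_subset[of _ "Pow {1..n}"]) auto
      have X: "int (card ?X) \<le> 4 * ?c 2"
        using card_all_classes[of ?U n "int d + 1" 4 3] n6 by (simp add: eval_nat_numeral)
      have YX: "?Y {x, 3, 4} \<subseteq> ?X" if "x \<in> {1, 2}" for x
      proof
        fix G assume G: "G \<in> ?Y {x, 3, 4}"
        then have "G \<inter> {1..6} = {x, 3, 4}" by (simp add: slice_def)
        moreover have "G \<inter> {1..4} = G \<inter> {1..6} \<inter> {1..4}" by auto
        ultimately have "G \<inter> {1..4} = {x, 3, 4}" using that by auto
        with G that show "G \<in> ?X" by (auto simp: slice_def)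
      qed
      have sub: "?C 3 \<subseteq> ?X" using level_subset[of 1] by auto
      have out: "?C 3 \<inter> (?Y {1, 3, 4} \<union> ?Y {2, 3, 4}) = {}"
        using avoid[of _ 1] avoid[of _ 2] by blast
      have "{1, 3, 4} \<noteq> {2, 3, 4::nat}" by auto
      then have disj: "?Y {1, 3, 4} \<inter> ?Y {2, 3, 4} = {}"
        by (auto simp: slice_def simp del: insert_iff)
      have "card (?C 3) + card (?Y {1, 3, 4} \<union> ?Y {2, 3, 4})
          = card (?C 3 \<union> (?Y {1, 3, 4} \<union> ?Y {2, 3, 4}))"
        by (rule card_Un_disjoint[symmetric, OF _ _ out]) auto
      also have "\<dots> \<le> card ?X"
        using sub YX[of 1] YX[of 2] by (intro card_mono[OF finX]) auto
      also have "card (?Y {1, 3, 4} \<union> ?Y {2, 3, 4}) = card (?Y {1, 3, 4}) + card (?Y {2, 3, 4})"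
        by (rule card_Un_disjoint[OF _ _ disj]) auto
      finally have "card (?C 3) + card (?Y {1, 3, 4}) + card (?Y {2, 3, 4}) \<le> card ?X"
        by simp
      with X Y_card[of 1] Y_card[of 2] show ?thesis by simp
    qed
    have e5: "5 * ?e (l + 1) \<le> ?e l" if "2 \<le> l" for l
      using ibinom_ratio[of 5 "int d - l" "n - 6"] that n6 large by (simp add: of_nat_diff algebra_simps)
    have "?c 2 = ?e 2 + 2 * ?e 3 + ?e 4"
      using ibinom_drop2[of "n - 4" "int d - 2"] n6 by simp
    moreover have "5 * ?e 3 \<le> ?e 2" "5 * ?e 4 \<le> ?e 3" using e5[of 2] e5[of 3] by auto
    ultimately show ?thesis
      unfolding target using C012 C3'
      by (intro prefix_count_gap[OF card_by_levels split upper[unfolded top] c_ratios ibinom_nonneg C4])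
  qed
qed

lemma card_le: "card A \<le> (n - 2) choose (d - 1)"
proof -
  have "int (card A) \<le> ibinom (n - 2) (int d - 1)"
    using card_le_with_witness[of 4] card_le_without_witness by auto
  also have "int d - 1 = int (d - 1)" using d_pos by simp
  finally show ?thesis unfolding ibinom_of_nat of_nat_le_iff .
qed

end

theorem theorem1p7:
  fixes n d :: nat and \<F> :: "nat set set"
  assumes "n > 0" and "d > 0"
    and "n \<ge> 6 * d"
    and "\<F> \<subseteq> Pow {1..n}"
    and "union_bounded (2 * d) \<F>"
  shows "card (\<F> - katona_even n d) \<le> (n - 2) choose (d - 1)"
proof -
  let ?A = "\<F> - katona_even n d"
  have "?A \<subseteq> Pow {1..n}" "union_bounded (2 * d) ?A"
    using assms(4,5) by (auto simp: union_bounded_def)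
  moreover have "d + 1 \<le> card F" if "F \<in> ?A" for F
    using that assms(4) by (auto simp: katona_even_def)
  ultimately obtain B where "B \<subseteq> Pow {1..n}" "\<And>F. F \<in> B \<Longrightarrow> d + 1 \<le> card F"
    "union_bounded (2 * d) B" "card B = card ?A" "shifted B"
    using exists_shifted[of ?A n "d + 1" "2 * d"] by metis
  moreover from this have "shifted_union_family n d B"
    using assms(2,3) by unfold_locales auto
  ultimately show ?thesis
    using shifted_union_family.card_le by metis
qed

end
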